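(* Let $\{\mathcal{S}_1,\mathcal{S}_2,\mathcal{S}_3,\mathcal{S}_4,\mathcal{S}_5\}$ be a complete set of maximal commuting classes of two-qubit Pauli operators ($d=4$). Then there exists exactly one maximal commuting class $\mathcal{S}\subseteq \mathcal{S}_1\cup\mathcal{S}_2\cup\mathcal{S}_3$ distinct from $\mathcal{S}_1,\mathcal{S}_2,\mathcal{S}_3$. Moreover, $\{\mathcal{S},\mathcal{S}_4,\mathcal{S}_5\}$ is an unextendible set of Pauli classes, and their common eigenbases form a weakly unextendible set of three mutually unbiased bases in $\mathbb{C}^4$.
   Context: Two-qubit Pauli operators are the tensor products $P_1\otimes P_2$ with $P_k\in\{I,X,Y,Z\}$ (standard Pauli matrices). A maximal commuting class in $d=4$ is a set of $3$ mutually commuting non-identity two-qubit Pauli operators (it has the form $\{U,V,UV\}$ up to phase). A complete set of classes is a family of $5$ pairwise disjoint maximal commuting classes whose union is the set of all $15$ non-identity two-qubit Pauli operators. A set of pairwise disjoint maximal commuting classes $\{\mathcal{C}_1,\dots,\mathcal{C}_L\}$ is unextendible if no further maximal commuting class can be formed from the non-identity Pauli operators not in $\mathcal{C}_1\cup\dots\cup\mathcal{C}_L$. Two orthonormal bases of $\mathbb{C}^d$ are mutually unbiased if $|\langle a|b\rangle|=1/\sqrt d$ for all vectors $a$ of the first and $b$ of the second; the common eigenbases of pairwise disjoint maximal commuting Pauli classes are mutually unbiased. A set of mutually unbiased bases obtained as common eigenbases of Pauli classes is weakly unextendible if there is no further basis, unbiased to all of them, that is the common eigenbasis of a maximal commuting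 class of Pauli operators. *)

theory Defs
  imports Complex_Main
begin

text \<open>Matrices are represented as functions nat => nat => complex, with the
convention that entries outside the index range are 0. Vectors of C^4 are
functions nat => complex (only indices < 4 matter).\<close>

type_synonym cmat = "nat \<Rightarrow> nat \<Rightarrow> complex"
type_synonym cvec = "nat \<Rightarrow> complex"

text \<open>Single-qubit Pauli matrices: 0 = I, 1 = X, 2 = Y, 3 = Z.\<close>
definition pauli1 :: "nat \<Rightarrow> cmat" where
  "pauli1 a i j =
     (if i < 2 \<and> j < 2 then
        (if a = 0 then (if i = j then 1 else 0)
         else if a = 1 then (if i = j then 0 else 1)
         else if a = 2 then (if i = j then 0 else if i = 0 then - \<i> else \<i>)
         else if a = 3 then (if i = j then (if i = 0 then 1 else -1) else 0)
         else 0)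
      else 0)"

definition tensor2 :: "cmat \<Rightarrow> cmat \<Rightarrow> cmat" where
  "tensor2 A B i j =
     (if i < 4 \<and> j < 4 then A (i div 2) (j div 2) * B (i mod 2) (j mod 2) else 0)"

definition mult4 :: "cmat \<Rightarrow> cmat \<Rightarrow> cmat" where
  "mult4 A B i j = (if i < 4 \<and> j < 4 then (\<Sum>k<4. A i k * B k j) else 0)"

definition mulv4 :: "cmat \<Rightarrow> cvec \<Rightarrow> cvec" where
  "mulv4 A v i = (\<Sum>k<4. A i k * v k)"

definition inner4 :: "cvec \<Rightarrow> cvec \<Rightarrow> complex" where
  "inner4 u v = (\<Sum>i<4. cnj (u i) * v i)"

definition pauli2 :: "nat \<Rightarrow> nat \<Rightarrow> cmat" where
  "pauli2 a b = tensor2 (pauli1 a) (pauli1 b)"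

definition nonid_paulis :: "cmat set" where
  "nonid_paulis = {pauli2 a b | a b. a < 4 \<and> b < 4 \<and> (a, b) \<noteq> (0, 0)}"

definition max_comm_class :: "cmat set \<Rightarrow> bool" where
  "max_comm_class C \<longleftrightarrow> C \<subseteq> nonid_paulis \<and> card C = 3 \<and>
     (\<forall>P\<in>C. \<forall>Q\<in>C. mult4 P Q = mult4 Q P)"

definition disjoint_classes :: "cmat set set \<Rightarrow> bool" where
  "disjoint_classes F \<longleftrightarrow> (\<forall>C\<in>F. max_comm_class C) \<and>
     (\<forall>C\<in>F. \<forall>D\<in>F. C \<noteq> D \<longrightarrow> C \<inter> D = {})"

definition unextendible_classes :: "cmat set set \<Rightarrow> bool" where
  "unextendible_classes F \<longleftrightarrow> disjoint_classes F \<and>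
     \<not> (\<exists>C. max_comm_class C \<and> C \<subseteq> nonid_paulis - \<Union>F)"

definition onb4 :: "(nat \<Rightarrow> cvec) \<Rightarrow> bool" where
  "onb4 B \<longleftrightarrow> (\<forall>k<4. \<forall>l<4. inner4 (B k) (B l) = (if k = l then 1 else 0))"

definition eigvec4 :: "cmat \<Rightarrow> cvec \<Rightarrow> bool" where
  "eigvec4 P v \<longleftrightarrow> (\<exists>c. \<forall>i<4. mulv4 P v i = c * v i)"

definition common_eigenbasis :: "cmat set \<Rightarrow> (nat \<Rightarrow> cvec) \<Rightarrow> bool" where
  "common_eigenbasis C B \<longleftrightarrow> onb4 B \<and> (\<forall>P\<in>C. \<forall>k<4. eigvec4 P (B k))"

definition mutually_unbiased :: "(nat \<Rightarrow> cvec) \<Rightarrow> (nat \<Rightarrow> cvec) \<Rightarrow> bool" where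
  "mutually_unbiased A B \<longleftrightarrow> onb4 A \<and> onb4 B \<and>
     (\<forall>k<4. \<forall>l<4. cmod (inner4 (A k) (B l)) = 1 / sqrt 4)"

definition weakly_unextendible :: "(nat \<Rightarrow> cvec) set \<Rightarrow> bool" where
  "weakly_unextendible M \<longleftrightarrow>
     (\<forall>A\<in>M. \<forall>B\<in>M. A \<noteq> B \<longrightarrow> mutually_unbiased A B) \<and>
     \<not> (\<exists>C B. max_comm_class C \<and> common_eigenbasis C B \<and>
              (\<forall>A\<in>M. mutually_unbiased A B))"

end

theory Submission
  imports Defs
begin

text \<open>
  The fifteen maximal commuting classes are the lines of the generalized quadrangle of order (2,2)
  on the nonzero two-qubit labels. Two disjoint lines are avoided by exactly four lines, one of which
  meets the other three; in a complete set it is the new class, and since it meets every line that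
  avoids the two given ones, the resulting triple cannot be extended.

  For the bases, the Fierz identity gives |<v,w>|^2 = (sum over P of <v,Pv><w,Pw>)/4, the sum ranging over all
  sixteen Pauli operators. A unit common eigenvector v of a line satisfies <v,Pv> = 0 for nonidentity
  P off the line, because such a P anticommutes with a member of the line. Disjoint lines therefore
  give |<v,w>|^2 = 1/4. If the lines share a P and <v,w> is nonzero, then the eigenvalues of v and w
  at P agree, so |<v,w>|^2 is at least 1/2 and the bases are not unbiased.
\<close>


section \<open>Expansion of sums over two and four indices\<close>

lemma sum_lessThan_2: "(\<Sum>k<2::nat. f k) = f 0 + (f 1 :: 'a::comm_monoid_add)"
  by (simp add: numeral_2_eq_2)

lemma sum_lessThan_4: "(\<Sum>k<4::nat. f k) = f 0 + f 1 + f 2 + (f 3 :: 'a::comm_monoid_add)"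
  by (simp add: eval_nat_numeral)

lemma less_2_cases_nat: "(i::nat) < 2 \<Longrightarrow> i = 0 \<or> i = 1"
  by auto

lemma less_4_cases_nat: "(i::nat) < 4 \<Longrightarrow> i = 0 \<or> i = 1 \<or> i = 2 \<or> i = 3"
  by auto

subsection \<open>Algebra of two-qubit Pauli operators\<close>

definition pauli :: "nat \<times> nat \<Rightarrow> cmat" where
  "pauli x = pauli2 (fst x) (snd x)"

text \<open>Each tensor factor either commutes or anticommutes, and the two signs multiply. The
  tensor products therefore commute exactly when both factors commute or both anticommute, which is
  the equality of the two truth values.\<close>

definition commuting_labels :: "nat \<times> nat \<Rightarrow> nat \<times> nat \<Rightarrow> bool" where
  "commuting_labels x y \<longleftrightarrow>
     (fst x = 0 \<or> fst y = 0 \<or> fst x = fst y) = (snd x = 0 \<or> snd y = 0 \<or> snd x = snd y)"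

text \<open>On single-qubit labels, two distinct nonzero labels multiply to the third one, 6 - a - b.\<close>
definition label_mult1 :: "nat \<Rightarrow> nat \<Rightarrow> nat" where
  "label_mult1 a b = (if a = 0 then b else if b = 0 then a else if a = b then 0 else 6 - a - b)"

text \<open>Records XY = iZ and its cyclic shifts, with the opposite sign in the reversed
  order.\<close>

definition phase1 :: "nat \<Rightarrow> nat \<Rightarrow> complex" where
  "phase1 a b = (if a = 0 \<or> b = 0 \<or> a = b then 1
     else if (a, b) \<in> {(1, 2), (2, 3), (3, 1)} then \<i> else - \<i>)"

definition label_mult :: "nat \<times> nat \<Rightarrow> nat \<times> nat \<Rightarrow> nat \<times> nat" where
  "label_mult x y = (label_mult1 (fst x) (fst y), label_mult1 (snd x) (snd y))"

definition phase :: "nat \<times> nat \<Rightarrow> nat \<times> nat \<Rightarrow> complex" where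
  "phase x y = phase1 (fst x) (fst y) * phase1 (snd x) (snd y)"

definition labels :: "(nat \<times> nat) set" where
  "labels = {..<4} \<times> {..<4}"

lemma pauli1_mult:
  assumes "a < 4" "b < 4" "i < 2" "j < 2"
  shows "(\<Sum>k<2. pauli1 a i k * pauli1 b k j) = phase1 a b * pauli1 (label_mult1 a b) i j"
  using less_4_cases_nat[OF assms(1)] less_4_cases_nat[OF assms(2)]
    less_2_cases_nat[OF assms(3)] less_2_cases_nat[OF assms(4)]
  by (elim disjE; simp add: sum_lessThan_2 pauli1_def phase1_def label_mult1_def)

text \<open>Completeness of the Pauli basis of 2x2 matrices: the sum of P tensor P over the four
  Pauli matrices is twice the swap operator.\<close>

lemma sum_pauli1_Fierz:
  assumes "i < 2" "j < 2" "k < 2" "l < 2"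
  shows "(\<Sum>a<4. pauli1 a i j * pauli1 a k l) = (if i = l \<and> j = k then 2 else 0)"
  using assms[THEN less_2_cases_nat]
  by (elim disjE; simp add: sum_lessThan_4 pauli1_def)

lemma pauli1_hermitian: "a < 4 \<Longrightarrow> cnj (pauli1 a i j) = pauli1 a j i"
  by (auto simp: pauli1_def)

lemma pauli1_trace: "(\<Sum>i<2. pauli1 a i i) = (if a = 0 then 2 else 0)"
  by (simp add: sum_lessThan_2 pauli1_def)

lemma tensor2_mult:
  "mult4 (tensor2 A B) (tensor2 C D) =
   tensor2 (\<lambda>i j. \<Sum>k<2. A i k * C k j) (\<lambda>i j. \<Sum>k<2. B i k * D k j)"
  by (intro ext) (simp add: mult4_def tensor2_def sum_lessThan_4 sum_lessThan_2 algebra_simps)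

lemma pauli_outside: "\<not> (i < 4 \<and> j < 4) \<Longrightarrow> pauli x i j = 0"
  by (auto simp: pauli_def pauli2_def tensor2_def)

lemma pauli_mult:
  assumes "x \<in> labels" "y \<in> labels"
  shows "mult4 (pauli x) (pauli y) = (\<lambda>i j. phase x y * pauli (label_mult x y) i j)"
  using assms pauli1_mult
  by (intro ext)
    (auto simp: pauli_def pauli2_def tensor2_mult tensor2_def labels_def phase_def label_mult_def)

lemma pauli_hermitian: "x \<in> labels \<Longrightarrow> cnj (pauli x i j) = pauli x j i"
  by (auto simp: pauli_def pauli2_def tensor2_def labels_def pauli1_hermitian)

lemma pauli_identity: "i < 4 \<Longrightarrow> j < 4 \<Longrightarrow> pauli (0, 0) i j = (if i = j then 1 else 0)"
  by (auto simp: pauli_def pauli2_def tensor2_def pauli1_def dest!: less_4_cases_nat)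

lemma pauli_trace: "(\<Sum>i<4. pauli x i i) = (if x = (0, 0) then 4 else 0)"
proof -
  have "(\<Sum>i<4. pauli x i i) = (\<Sum>i<2. pauli1 (fst x) i i) * (\<Sum>i<2. pauli1 (snd x) i i)"
    by (simp add: sum_lessThan_4 sum_lessThan_2 pauli_def pauli2_def tensor2_def algebra_simps)
  then show ?thesis
    by (auto simp: pauli1_trace prod_eq_iff)
qed

lemma sum_pauli_Fierz:
  assumes "i < 4" "j < 4" "k < 4" "l < 4"
  shows "(\<Sum>x\<in>labels. pauli x i j * pauli x k l) = (if i = l \<and> j = k then 4 else 0)"
proof -
  \<comment> \<open>The quotient and remainder modulo 2 are the two qubit indices, so the sum over
    label pairs factors into two single-qubit sums.\<close>
  have eq: "m = n \<longleftrightarrow> m div 2 = n div 2 \<and> m mod 2 = n mod 2" for m n :: nat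
    by (metis div_mult_mod_eq)
  have "(\<Sum>x\<in>labels. pauli x i j * pauli x k l) =
    (\<Sum>a<4. pauli1 a (i div 2) (j div 2) * pauli1 a (k div 2) (l div 2)) *
    (\<Sum>b<4. pauli1 b (i mod 2) (j mod 2) * pauli1 b (k mod 2) (l mod 2))"
    using assms
    by (simp add: labels_def sum.cartesian_product sum_product case_prod_unfold pauli_def pauli2_def
        tensor2_def mult_ac)
  also have "\<dots> = (if i = l \<and> j = k then 4 else 0)"
    using assms by (subst (1 2) sum_pauli1_Fierz) (auto simp: eq[of i l] eq[of j k])
  finally show ?thesis .
qed

lemma label_mult_in_labels: "x \<in> labels \<Longrightarrow> y \<in> labels \<Longrightarrow> label_mult x y \<in> labels"
  by (auto simp: labels_def label_mult_def label_mult1_def)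

lemma label_mult_commute: "label_mult x y = label_mult y x"
  by (auto simp: label_mult_def label_mult1_def)

lemma label_mult_self: "label_mult x x = (0, 0)"
  by (simp add: label_mult_def label_mult1_def)

lemma label_mult_eq_identity_iff:
  "x \<in> labels \<Longrightarrow> y \<in> labels \<Longrightarrow> label_mult x y = (0, 0) \<longleftrightarrow> x = y"
  by (auto simp: labels_def label_mult_def label_mult1_def split: if_splits)

lemma phase_nonzero: "phase x y \<noteq> 0"
  by (simp add: phase_def phase1_def)

lemma phase_self: "phase x x = 1"
  by (simp add: phase_def phase1_def)

lemma phase1_commute:
  assumes "a < 4" "b < 4"
  shows "phase1 a b = (if a = 0 \<or> b = 0 \<or> a = b then 1 else - 1) * phase1 b a"
  using less_4_cases_nat[OF assms(1)] less_4_cases_nat[OF assms(2)]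
  by (elim disjE; simp add: phase1_def)

lemma phase_commute:
  assumes "x \<in> labels" "y \<in> labels"
  shows "phase x y = (if commuting_labels x y then 1 else - 1) * phase y x"
  using assms phase1_commute[of "fst x" "fst y"] phase1_commute[of "snd x" "snd y"]
  by (simp add: labels_def mem_Times_iff phase_def commuting_labels_def split: if_split)

lemma pauli_nonzero: "x \<in> labels \<Longrightarrow> pauli x \<noteq> (\<lambda>i j. 0)"
  using fun_cong[OF fun_cong[OF pauli_mult[of x x], of 0], of 0] pauli_identity[of 0 0]
  by (auto simp: phase_self label_mult_self mult4_def)

text \<open>Products in the two orders agree up to the sign from \<open>phase_commute\<close>. If
  that sign is -1, commutation would force a Pauli operator to vanish.\<close>

lemma pauli_commute_iff:
  assumes "x \<in> labels" "y \<in> labels"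
  shows "mult4 (pauli x) (pauli y) = mult4 (pauli y) (pauli x) \<longleftrightarrow> commuting_labels x y"
proof -
  have "commuting_labels x y" if eq: "mult4 (pauli x) (pauli y) = mult4 (pauli y) (pauli x)"
  proof (rule ccontr)
    assume "\<not> commuting_labels x y"
    then have "pauli (label_mult y x) i j = 0" for i j
      using fun_cong[OF fun_cong[OF eq, of i], of j] assms phase_nonzero[of y x]
      by (simp add: pauli_mult phase_commute[of x y] label_mult_commute[of x y])
    then show False
      using pauli_nonzero[OF label_mult_in_labels[OF assms(2,1)]] by (simp add: fun_eq_iff)
  qed
  then show ?thesis
    using assms by (auto simp: pauli_mult phase_commute[of x y] label_mult_commute[of x y])
qed

text \<open>If two labels give the same operator, their product is the identity and has trace 4. A
  product of Pauli operators is traceless unless its label is \<open>(0, 0)\<close>, which forces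
  the labels to be equal.\<close>

lemma inj_on_pauli: "inj_on pauli labels"
proof (rule inj_onI)
  fix x y assume xy: "x \<in> labels" "y \<in> labels" and eq: "pauli x = pauli y"
  have "phase x y * (\<Sum>i<4. pauli (label_mult x y) i i) = (\<Sum>i<4. pauli (0, 0) i i)"
    using fun_cong[OF fun_cong[OF pauli_mult[OF xy]]] xy
    by (simp add: eq pauli_mult phase_self label_mult_self sum_distrib_left)
  then show "x = y"
    using xy by (auto simp: pauli_trace label_mult_eq_identity_iff split: if_splits)
qed

subsection \<open>Pauli expectation values and eigenvectors\<close>

text \<open>Vectors are functions on all naturals, while eigenvalue equations hold only for indices
  below 4. This congruence and the next one let such equations be substituted.\<close>

lemma mulv4_cong: "(\<And>i. i < 4 \<Longrightarrow> v i = w i) \<Longrightarrow> mulv4 A v = mulv4 A w"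
  by (auto simp: mulv4_def intro!: sum.cong)

lemma inner4_cong:
  "(\<And>i. i < 4 \<Longrightarrow> v i = v' i) \<Longrightarrow> (\<And>i. i < 4 \<Longrightarrow> w i = w' i) \<Longrightarrow> inner4 v w = inner4 v' w'"
  by (auto simp: inner4_def intro!: sum.cong)

lemma mulv4_scale: "mulv4 A (\<lambda>i. c * v i) = (\<lambda>i. c * mulv4 A v i)"
  by (auto simp: mulv4_def sum_distrib_left mult_ac)

lemma mulv4_add: "mulv4 A (\<lambda>i. v i + w i) = (\<lambda>i. mulv4 A v i + mulv4 A w i)"
  by (auto simp: mulv4_def sum.distrib algebra_simps)

lemma inner4_scale_right: "inner4 v (\<lambda>i. c * w i) = c * inner4 v w"
  by (auto simp: inner4_def sum_distrib_left mult_ac)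

lemma inner4_scale_left: "inner4 (\<lambda>i. c * v i) w = cnj c * inner4 v w"
  by (auto simp: inner4_def sum_distrib_left mult_ac)

lemma cnj_inner4: "cnj (inner4 v w) = inner4 w v"
  by (simp add: inner4_def mult_ac)

lemma mulv4_identity: "i < 4 \<Longrightarrow> mulv4 (pauli (0, 0)) v i = v i"
  by (auto simp: mulv4_def pauli_identity if_distrib[of "\<lambda>c. c * _"] cong: if_cong)

lemma mulv4_pauli_pauli:
  assumes "x \<in> labels" "y \<in> labels"
  shows "mulv4 (pauli x) (mulv4 (pauli y) v) = (\<lambda>i. phase x y * mulv4 (pauli (label_mult x y)) v i)"
proof
  fix i
  show "mulv4 (pauli x) (mulv4 (pauli y) v) i = phase x y * mulv4 (pauli (label_mult x y)) v i"
  proof (cases "i < 4")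
    case True
    have "mulv4 (pauli x) (mulv4 (pauli y) v) i = (\<Sum>k<4. mult4 (pauli x) (pauli y) i k * v k)"
      using True by (simp add: mulv4_def mult4_def sum_lessThan_4 algebra_simps)
    then show ?thesis
      using assms by (simp add: pauli_mult mulv4_def sum_distrib_left mult_ac)
  next
    case False
    \<comment> \<open>\<open>mulv4\<close> does not truncate its result, but the rows of a Pauli
      operator from 4 on are zero, so the equality holds for whole functions.\<close>
    then show ?thesis by (simp add: mulv4_def pauli_outside)
  qed
qed

lemma inner4_pauli:
  assumes "x \<in> labels"
  shows "inner4 v (mulv4 (pauli x) w) = inner4 (mulv4 (pauli x) v) w"
proof -
  have "inner4 v (mulv4 (pauli x) w) = (\<Sum>i<4. \<Sum>k<4. cnj (v i) * pauli x i k * w k)"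
    by (simp add: inner4_def mulv4_def sum_distrib_left mult_ac)
  also have "\<dots> = (\<Sum>k<4. \<Sum>i<4. cnj (v i) * pauli x i k * w k)"
    by (rule sum.swap)
  also have "\<dots> = inner4 (mulv4 (pauli x) v) w"
    using assms by (simp add: inner4_def mulv4_def sum_distrib_left sum_distrib_right pauli_hermitian mult_ac)
  finally show ?thesis .
qed

definition pauli_mean :: "nat \<times> nat \<Rightarrow> cvec \<Rightarrow> complex" where
  "pauli_mean x v = inner4 v (mulv4 (pauli x) v)"

lemma pauli_mean_identity: "pauli_mean (0, 0) v = inner4 v v"
  by (simp add: pauli_mean_def mulv4_identity cong: inner4_cong)

lemma sum_pauli_mean:
  "(\<Sum>x\<in>labels. pauli_mean x v * pauli_mean x w) = 4 * complex_of_real ((cmod (inner4 v w))\<^sup>2)"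
proof -
  have mean: "pauli_mean x v = (\<Sum>i<4. \<Sum>j<4. cnj (v i) * v j * pauli x i j)" for x v
    by (simp add: pauli_mean_def inner4_def mulv4_def sum_distrib_left mult_ac)
  have "(\<Sum>x\<in>labels. pauli_mean x v * pauli_mean x w) =
    (\<Sum>x\<in>labels. \<Sum>i<4. \<Sum>k<4. \<Sum>j<4. \<Sum>l<4.
       cnj (v i) * v j * pauli x i j * (cnj (w k) * w l * pauli x k l))"
    by (simp add: mean sum_product)
  \<comment> \<open>The label sum is moved innermost, where the Fierz identity applies.\<close>
  also have "\<dots> = (\<Sum>i<4. \<Sum>k<4. \<Sum>j<4. \<Sum>l<4. \<Sum>x\<in>labels.
       cnj (v i) * v j * pauli x i j * (cnj (w k) * w l * pauli x k l))"
    by (simp only: sum.swap[of _ _ labels])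
  also have "\<dots> = (\<Sum>i<4. \<Sum>k<4. \<Sum>j<4. \<Sum>l<4.
       cnj (v i) * v j * cnj (w k) * w l * (\<Sum>x\<in>labels. pauli x i j * pauli x k l))"
    by (simp add: sum_distrib_left mult_ac)
  also have "\<dots> = (\<Sum>i<4. \<Sum>k<4. \<Sum>j<4. \<Sum>l<4.
       cnj (v i) * v j * cnj (w k) * w l * (if i = l \<and> j = k then 4 else 0))"
    by (intro sum.cong refl arg_cong2[of _ _ _ _ "(*)"] sum_pauli_Fierz) simp_all
  \<comment> \<open>Nesting the two conditions lets the sums over \<open>l\<close> and
    \<open>j\<close> collapse one at a time; what remains factors into two inner products.\<close>
  also have "\<dots> = (\<Sum>i<4. \<Sum>k<4. \<Sum>j<4. \<Sum>l<4.
       if i = l then if j = k then 4 * (cnj (v i) * w l * (cnj (w k) * v j)) else 0 else 0)"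
    by (intro sum.cong refl) simp
  also have "\<dots> = 4 * (inner4 v w * inner4 w v)"
    by (simp add: inner4_def sum_product) (simp add: sum_distrib_left)
  also have "inner4 v w * inner4 w v = complex_of_real ((cmod (inner4 v w))\<^sup>2)"
    using complex_norm_square[of "inner4 v w"] by (simp add: cnj_inner4)
  finally show ?thesis .
qed

text \<open>Pairing the eigenvalue equation with the unit vector \<open>v\<close> identifies the
  eigenvalue as the expectation value.\<close>

lemma eigvec4_pauliD:
  assumes "eigvec4 (pauli x) v" "inner4 v v = 1"
  shows "\<And>i. i < 4 \<Longrightarrow> mulv4 (pauli x) v i = pauli_mean x v * v i"
proof -
  obtain c where c: "\<And>i. i < 4 \<Longrightarrow> mulv4 (pauli x) v i = c * v i"
    using assms(1) by (auto simp: eigvec4_def)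
  have "pauli_mean x v = inner4 v (\<lambda>i. c * v i)"
    unfolding pauli_mean_def by (rule inner4_cong) (simp_all add: c)
  also have "\<dots> = c"
    by (simp add: inner4_scale_right assms)
  finally show "mulv4 (pauli x) v i = pauli_mean x v * v i" if "i < 4" for i
    using c that by simp
qed

text \<open>Every Pauli operator squares to the identity, hence so does its eigenvalue to 1.\<close>

lemma pauli_mean_eigvec4_square:
  assumes "x \<in> labels" "eigvec4 (pauli x) v" "inner4 v v = 1"
  shows "pauli_mean x v * pauli_mean x v = 1"
proof -
  let ?c = "pauli_mean x v"
  have "1 = inner4 v (mulv4 (pauli x) (mulv4 (pauli x) v))"
    using assms by (simp add: mulv4_pauli_pauli phase_self label_mult_self mulv4_identity cong: inner4_cong)
  also have "mulv4 (pauli x) (mulv4 (pauli x) v) = mulv4 (pauli x) (\<lambda>i. ?c * v i)"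
    by (rule mulv4_cong) (rule eigvec4_pauliD[OF assms(2,3)])
  also have "inner4 v \<dots> = ?c * ?c"
    by (simp add: mulv4_scale inner4_scale_right pauli_mean_def)
  finally show ?thesis by simp
qed

lemma pauli_mean_real: "x \<in> labels \<Longrightarrow> cnj (pauli_mean x v) = pauli_mean x v"
  by (simp add: pauli_mean_def cnj_inner4 inner4_pauli)

lemma inner4_pauli_eigvec4:
  assumes "x \<in> labels" "eigvec4 (pauli x) v" "inner4 v v = 1"
  shows "inner4 v (mulv4 (pauli x) w) = pauli_mean x v * inner4 v w"
proof -
  have "inner4 v (mulv4 (pauli x) w) = inner4 (\<lambda>i. pauli_mean x v * v i) w"
    unfolding inner4_pauli[OF assms(1)]
    by (rule inner4_cong) (simp_all add: eigvec4_pauliD[OF assms(2,3)])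
  then show ?thesis
    using assms by (simp add: inner4_scale_left pauli_mean_real)
qed

text \<open>With P for \<open>x\<close>, Q for \<open>y\<close> and c the eigenvalue of P at
  \<open>v\<close>: c<Q> = <PQ> = -<QP> = -c<Q>, and c is nonzero because its square is 1.\<close>

lemma pauli_mean_anticommuting:
  assumes "x \<in> labels" "y \<in> labels" "\<not> commuting_labels x y"
    and v: "eigvec4 (pauli x) v" "inner4 v v = 1"
  shows "pauli_mean y v = 0"
proof -
  let ?c = "pauli_mean x v"
  have "?c * pauli_mean y v = inner4 v (mulv4 (pauli x) (mulv4 (pauli y) v))"
    unfolding pauli_mean_def[of y] by (rule inner4_pauli_eigvec4[symmetric]) (fact+)
  also have "\<dots> = - inner4 v (mulv4 (pauli y) (mulv4 (pauli x) v))"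
    using assms by (simp only: mulv4_pauli_pauli inner4_scale_right phase_commute[of x y]
        label_mult_commute[of x y]) simp
  also have "mulv4 (pauli y) (mulv4 (pauli x) v) = mulv4 (pauli y) (\<lambda>i. ?c * v i)"
    by (rule mulv4_cong) (rule eigvec4_pauliD[OF v])
  also have "- inner4 v \<dots> = - (?c * pauli_mean y v)"
    by (simp add: mulv4_scale inner4_scale_right pauli_mean_def)
  finally have "?c * pauli_mean y v = 0"
    by simp
  then show ?thesis
    using pauli_mean_eigvec4_square[OF assms(1) v] by auto
qed

text \<open>Eigenvectors of a Hermitian operator for different eigenvalues are orthogonal.\<close>

lemma pauli_mean_eq_of_not_orthogonal:
  assumes "x \<in> labels" "eigvec4 (pauli x) v" "inner4 v v = 1"
    and "eigvec4 (pauli x) w" "inner4 w w = 1" "inner4 v w \<noteq> 0"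
  shows "pauli_mean x v = pauli_mean x w"
proof -
  have "pauli_mean x v * inner4 v w = inner4 v (mulv4 (pauli x) w)"
    using assms by (simp add: inner4_pauli_eigvec4)
  also have "\<dots> = inner4 v (\<lambda>i. pauli_mean x w * w i)"
    by (rule inner4_cong) (simp_all add: eigvec4_pauliD[OF assms(4,5)])
  finally show ?thesis
    using assms by (simp add: inner4_scale_right)
qed

lemma inner4_self: "inner4 v v = complex_of_real (\<Sum>i<4. (cmod (v i))\<^sup>2)"
  by (simp add: inner4_def complex_norm_square mult_ac del: of_real_power)

lemma exists_common_eigenvector:
  assumes xy: "x \<in> labels" "y \<in> labels" "x \<noteq> (0, 0)" "y \<noteq> (0, 0)" "x \<noteq> y"
    and comm: "commuting_labels x y" and st: "s * s = 1" "t * t = 1"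
  obtains v where "inner4 v v = 1" "\<And>i. i < 4 \<Longrightarrow> mulv4 (pauli x) v i = s * v i"
    "\<And>i. i < 4 \<Longrightarrow> mulv4 (pauli y) v i = t * v i"
proof -
  \<comment> \<open>The j-th vector u is the j-th column of (1 + s X)(1 + t Y), whose trace is 4.\<close>
  define e :: "nat \<Rightarrow> cvec" where "e = (\<lambda>j i. if i = j then 1 else 0)"
  define u :: "nat \<Rightarrow> cvec" where "u = (\<lambda>j i. e j i + s * mulv4 (pauli x) (e j) i +
    t * (mulv4 (pauli y) (e j) i + s * mulv4 (pauli x) (mulv4 (pauli y) (e j)) i))"
  have diag: "mulv4 (pauli z) (e j) j = pauli z j j" if "j < 4" for z j
    using that by (auto simp: mulv4_def e_def if_distrib[of "\<lambda>c. _ * c"] cong: if_cong)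
  have e_diag: "e j j = 1" for j
    by (simp add: e_def)
  have "(\<Sum>j<4. u j j) = 4 + s * (\<Sum>j<4. pauli x j j) +
      t * ((\<Sum>j<4. pauli y j j) + s * phase x y * (\<Sum>j<4. pauli (label_mult x y) j j))"
    using xy by (simp add: u_def diag e_diag mulv4_pauli_pauli sum.distrib sum_distrib_left mult_ac distrib_left)
  \<comment> \<open>The labels \<open>x\<close>, \<open>y\<close> and their product are all
    different from \<open>(0, 0)\<close>, the last because \<open>x\<close> and \<open>y\<close>
    differ, so only the identity contributes to the trace.\<close>
  also have "\<dots> = 4"
    using xy by (simp add: pauli_trace label_mult_eq_identity_iff)
  finally have "(\<Sum>j<4. u j j) \<noteq> 0"
    by simp
  \<comment> \<open>A nonzero trace yields a nonzero diagonal entry, hence a nonzero column.\<close>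
  then obtain j where j: "j < 4" "u j j \<noteq> 0"
    by (auto elim: sum.not_neutral_contains_not_neutral)
  let ?e = "e j" and ?u = "u j"
  have xx: "mulv4 (pauli x) (mulv4 (pauli x) w) i = w i"
    and yy: "mulv4 (pauli y) (mulv4 (pauli y) w) i = w i" if "i < 4" for w i
    using that xy by (simp_all add: mulv4_pauli_pauli phase_self label_mult_self mulv4_identity)
  have xyy: "mulv4 (pauli x) (mulv4 (pauli y) (mulv4 (pauli y) w)) = mulv4 (pauli x) w" for w
    by (rule mulv4_cong) (rule yy)
  have yx: "mulv4 (pauli y) (mulv4 (pauli x) w) = mulv4 (pauli x) (mulv4 (pauli y) w)" for w
    using xy comm by (simp add: mulv4_pauli_pauli phase_commute[of x y] label_mult_commute[of x y])
  \<comment> \<open>Because the signs square to 1, X(1 + s X) = s(1 + s X), and similarly for Y and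
    t. This makes the column a joint eigenvector.\<close>
  have ss: "s * (s * c) = c" and tt: "t * (t * c) = c" for c
    using st by (simp_all add: mult.assoc[symmetric])
  have ux: "mulv4 (pauli x) ?u i = s * ?u i" if "i < 4" for i
    using that by (simp add: u_def mulv4_add mulv4_scale xx yy xyy yx algebra_simps ss tt)
  have uy: "mulv4 (pauli y) ?u i = t * ?u i" if "i < 4" for i
    using that by (simp add: u_def mulv4_add mulv4_scale xx yy xyy yx algebra_simps ss tt)
  define n where "n = (\<Sum>i<4. (cmod (?u i))\<^sup>2)"
  have n: "n > 0" unfolding n_def
    by (rule sum_pos2[of _ j]) (use j in auto)
  define v where "v = (\<lambda>i. complex_of_real (1 / sqrt n) * ?u i)"
  show ?thesis
  proof
    have "inner4 v v = complex_of_real (1 / sqrt n * (1 / sqrt n) * n)"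
      unfolding v_def inner4_scale_left inner4_scale_right inner4_self n_def[symmetric]
      by (simp only: complex_cnj_complex_of_real of_real_mult mult.assoc)
    also have "1 / sqrt n * (1 / sqrt n) * n = 1"
      using n by (simp add: field_simps)
    finally show "inner4 v v = 1" by simp
  qed (simp_all only: v_def mulv4_scale ux uy mult.left_commute)
qed

subsection \<open>Lines of commuting labels\<close>

definition nonid_labels :: "(nat \<times> nat) list" where
  "nonid_labels = filter (\<lambda>x. x \<noteq> (0, 0)) (List.product [0..<4] [0..<4])"

text \<open>The first nine lines consist of P tensor I, I tensor Q and P tensor Q. The last six are
  the graphs of the permutations of {1, 2, 3}, first the even and then the odd ones.\<close>

definition label_lines :: "(nat \<times> nat) set list" where
  "label_lines =
    [{(1,0),(0,1),(1,1)}, {(1,0),(0,2),(1,2)}, {(1,0),(0,3),(1,3)},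
     {(2,0),(0,1),(2,1)}, {(2,0),(0,2),(2,2)}, {(2,0),(0,3),(2,3)},
     {(3,0),(0,1),(3,1)}, {(3,0),(0,2),(3,2)}, {(3,0),(0,3),(3,3)},
     {(1,1),(2,2),(3,3)}, {(1,2),(2,3),(3,1)}, {(1,3),(2,1),(3,2)},
     {(1,1),(2,3),(3,2)}, {(1,2),(2,1),(3,3)}, {(1,3),(2,2),(3,1)}]"

lemma label_lines_complete:
  "\<forall>x\<in>set nonid_labels. \<forall>y\<in>set nonid_labels. x \<noteq> y \<and> commuting_labels x y \<longrightarrow>
     (\<forall>z\<in>set nonid_labels. x \<noteq> z \<and> y \<noteq> z \<and> commuting_labels x z \<and> commuting_labels y z \<longrightarrow>
        {x, y, z} \<in> set label_lines)"
  by code_simp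

lemma label_lines_commuting:
  "\<forall>L\<in>set label_lines. L \<subseteq> set nonid_labels \<and> card L = 3 \<and> (\<forall>x\<in>L. \<forall>y\<in>L. commuting_labels x y)"
  by code_simp

text \<open>Supplies the anticommuting partner that makes expectation values vanish off a
  line.\<close>

lemma label_lines_maximal:
  "\<forall>L\<in>set label_lines. \<forall>x\<in>set nonid_labels. x \<in> L \<or> (\<exists>y\<in>L. \<not> commuting_labels y x)"
  by code_simp

text \<open>Allows joint eigenvectors of two points of a line to be recognized as eigenvectors of
  the third.\<close>

lemma label_lines_mult:
  "\<forall>L\<in>set label_lines. \<forall>x\<in>L. \<forall>y\<in>L. \<forall>z\<in>L. x \<noteq> y \<and> x \<noteq> z \<and> y \<noteq> z \<longrightarrow> z = label_mult x y"
  by code_simp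

lemma distinct_label_lines: "distinct label_lines"
  by code_simp

text \<open>The combinatorial core, settled by evaluation over all pairs of lines. The count is a
  list length to keep it computable; distinctness of the list later turns it into a
  cardinality.\<close>

lemma label_lines_disjoint_pair:
  "\<forall>A\<in>set label_lines. \<forall>B\<in>set label_lines. A \<inter> B = {} \<longrightarrow>
     (let Ls = filter (\<lambda>L. L \<inter> A = {} \<and> L \<inter> B = {}) label_lines
      in length Ls = 4 \<and> (\<exists>S\<in>set Ls. \<forall>T\<in>set Ls. T \<inter> S \<noteq> {}))"
  by code_simp

lemma set_nonid_labels: "set nonid_labels = labels - {(0, 0)}"
  by (auto simp: nonid_labels_def labels_def)

lemma label_line_subset: "L \<in> set label_lines \<Longrightarrow> L \<subseteq> labels - {(0, 0)}"
  using label_lines_commuting by (auto simp: set_nonid_labels)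

lemma nonid_paulis_eq: "nonid_paulis = pauli ` (labels - {(0, 0)})"
proof -
  have "{pauli2 a b | a b. a < 4 \<and> b < 4 \<and> (a, b) \<noteq> (0, 0)} =
      (\<lambda>(a, b). pauli2 a b) ` {(a, b). a < 4 \<and> b < 4 \<and> (a, b) \<noteq> (0, 0)}"
    by auto
  also have "{(a, b). a < 4 \<and> b < 4 \<and> (a, b) \<noteq> (0, 0)} = labels - {(0, 0)}"
    by (auto simp: labels_def)
  finally show ?thesis
    by (simp add: nonid_paulis_def pauli_def case_prod_unfold)
qed

text \<open>Transfers the problem from operators to labels: injectivity of \<open>pauli\<close>
  preserves the cardinality 3, and commutation of operators is commutation of labels.\<close>

lemma max_comm_class_iff: "max_comm_class C \<longleftrightarrow> (\<exists>L\<in>set label_lines. C = pauli ` L)"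
proof
  assume C: "max_comm_class C"
  then obtain L where L: "L \<subseteq> labels - {(0, 0)}" "C = pauli ` L"
    unfolding max_comm_class_def nonid_paulis_eq by (auto elim: subset_imageE)
  then have "card L = 3"
    using C card_image[OF inj_on_subset[OF inj_on_pauli, of L]] by (auto simp: max_comm_class_def)
  then obtain x y z where xyz: "L = {x, y, z}" "x \<noteq> y" "y \<noteq> z" "x \<noteq> z"
    by (auto simp: card_3_iff)
  have "commuting_labels a b" if "a \<in> L" "b \<in> L" for a b
    using that C L pauli_commute_iff[of a b] by (auto simp: max_comm_class_def)
  then have "L \<in> set label_lines"
    using label_lines_complete L xyz by (auto simp: set_nonid_labels)
  with L show "\<exists>L\<in>set label_lines. C = pauli ` L"
    by blast
next
  assume "\<exists>L\<in>set label_lines. C = pauli ` L"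
  then obtain L where L: "L \<in> set label_lines" and C: "C = pauli ` L"
    by blast
  have sub: "L \<subseteq> labels"
    using label_line_subset[OF L] by auto
  have "card C = 3"
    using C L label_lines_commuting inj_on_subset[OF inj_on_pauli sub] by (simp add: card_image)
  moreover have "mult4 (pauli x) (pauli y) = mult4 (pauli y) (pauli x)" if "x \<in> L" "y \<in> L" for x y
    using that L label_lines_commuting sub by (subst pauli_commute_iff) auto
  ultimately show "max_comm_class C"
    using label_line_subset[OF L] by (auto simp: max_comm_class_def nonid_paulis_eq C)
qed

lemma pauli_image_Int_empty_iff:
  assumes "L \<in> set label_lines" "M \<in> set label_lines"
  shows "pauli ` L \<inter> pauli ` M = {} \<longleftrightarrow> L \<inter> M = {}"
  using inj_on_image_Int[OF inj_on_pauli, of L M] assms[THEN label_line_subset] by auto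

subsection \<open>Common eigenbases\<close>

lemma exists_common_eigenbasis:
  assumes L: "L \<in> set label_lines"
  shows "\<exists>B. common_eigenbasis (pauli ` L) B"
proof -
  have "card L = 3"
    using L label_lines_commuting by blast
  then obtain x y z where xyz: "L = {x, y, z}" "x \<noteq> y" "x \<noteq> z" "y \<noteq> z"
    by (auto simp: card_3_iff)
  have z: "z = label_mult x y"
    using label_lines_mult[rule_format, OF L, of x y z] xyz by simp
  have lab: "x \<in> labels" "y \<in> labels" "x \<noteq> (0, 0)" "y \<noteq> (0, 0)"
    using label_line_subset[OF L] xyz by auto
  have comm: "commuting_labels x y"
    using bspec[OF label_lines_commuting L] xyz by simp
  \<comment> \<open>As \<open>k\<close> runs through 0 to 3, the pair \<open>(s k, t k)\<close>
    takes each of the four sign patterns once.\<close>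
  define s :: "nat \<Rightarrow> complex" where "s = (\<lambda>k. if k < 2 then 1 else - 1)"
  define t :: "nat \<Rightarrow> complex" where "t = (\<lambda>k. if even k then 1 else - 1)"
  have "\<exists>v. inner4 v v = 1 \<and> (\<forall>i<4. mulv4 (pauli x) v i = s k * v i) \<and>
      (\<forall>i<4. mulv4 (pauli y) v i = t k * v i)" for k
    by (rule exists_common_eigenvector[OF lab xyz(2) comm, of "s k" "t k"]) (auto simp: s_def t_def)
  then obtain B where unit: "\<And>k. inner4 (B k) (B k) = 1"
    and Bx: "\<And>k i. i < 4 \<Longrightarrow> mulv4 (pauli x) (B k) i = s k * B k i"
    and By: "\<And>k i. i < 4 \<Longrightarrow> mulv4 (pauli y) (B k) i = t k * B k i"
    by metis
  have ex: "eigvec4 (pauli x) (B k)" and ey: "eigvec4 (pauli y) (B k)" for k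
    using Bx By by (auto simp: eigvec4_def)
  have mx: "pauli_mean x (B k) = s k" for k
    using inner4_cong[of "B k" "B k" "mulv4 (pauli x) (B k)" "\<lambda>i. s k * B k i"] Bx unit
    by (simp add: pauli_mean_def inner4_scale_right)
  have my: "pauli_mean y (B k) = t k" for k
    using inner4_cong[of "B k" "B k" "mulv4 (pauli y) (B k)" "\<lambda>i. t k * B k i"] By unit
    by (simp add: pauli_mean_def inner4_scale_right)
  \<comment> \<open>Up to the nonzero factor \<open>phase x y\<close>, the third operator is the
    product of the first two.\<close>
  have ez: "eigvec4 (pauli z) (B k)" for k
  proof -
    have "phase x y * mulv4 (pauli z) (B k) i = t k * (s k * B k i)" if "i < 4" for i
    proof -
      have "phase x y * mulv4 (pauli z) (B k) i = mulv4 (pauli x) (mulv4 (pauli y) (B k)) i"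
        using lab z by (simp add: mulv4_pauli_pauli)
      also have "mulv4 (pauli x) (mulv4 (pauli y) (B k)) = mulv4 (pauli x) (\<lambda>i. t k * B k i)"
        by (rule mulv4_cong) (rule By)
      finally show ?thesis
        using that by (simp add: mulv4_scale Bx)
    qed
    then have "\<forall>i<4. mulv4 (pauli z) (B k) i = (t k * s k / phase x y) * B k i"
      using phase_nonzero[of x y] by (simp add: field_simps)
    then show ?thesis
      unfolding eigvec4_def by blast
  qed
  \<comment> \<open>Two different sign patterns give different eigenvalues for at least one of the
    two operators, which forces orthogonality.\<close>
  have "inner4 (B k) (B l) = 0" if "k < 4" "l < 4" "k \<noteq> l" for k l
  proof (rule ccontr)
    assume nz: "inner4 (B k) (B l) \<noteq> 0"
    have "s k = s l"
      using pauli_mean_eq_of_not_orthogonal[OF lab(1) ex unit ex unit nz] mx by simp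
    moreover have "t k = t l"
      using pauli_mean_eq_of_not_orthogonal[OF lab(2) ey unit ey unit nz] my by simp
    ultimately show False
      using that by (auto simp: s_def t_def dest!: less_4_cases_nat)
  qed
  then have "common_eigenbasis (pauli ` L) B"
    using ex ey ez unit by (auto simp: common_eigenbasis_def onb4_def xyz)
  then show ?thesis
    by blast
qed

text \<open>In the Fierz sum the identity contributes 1. Expectation values of \<open>v\<close>
  vanish off \<open>L\<close> and those of \<open>w\<close> off \<open>M\<close>, so otherwise only
  shared labels survive.\<close>

lemma cmod_inner4_line_eigenvectors:
  assumes L: "L \<in> set label_lines" and M: "M \<in> set label_lines"
    and v: "inner4 v v = 1" "\<And>x. x \<in> L \<Longrightarrow> eigvec4 (pauli x) v"
    and w: "inner4 w w = 1" "\<And>x. x \<in> M \<Longrightarrow> eigvec4 (pauli x) w"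
  shows "4 * complex_of_real ((cmod (inner4 v w))\<^sup>2) =
    1 + (\<Sum>x\<in>L \<inter> M. pauli_mean x v * pauli_mean x w)"
proof -
  have zero: "pauli_mean x u = 0"
    if "N \<in> set label_lines" "x \<in> labels - {(0, 0)}" "x \<notin> N" "inner4 u u = 1"
      "\<And>x. x \<in> N \<Longrightarrow> eigvec4 (pauli x) u" for N x u
  proof -
    obtain y where "y \<in> N" "\<not> commuting_labels y x"
      using label_lines_maximal \<open>N \<in> _\<close> \<open>x \<in> _\<close> \<open>x \<notin> N\<close> unfolding set_nonid_labels[symmetric] by blast
    then show ?thesis
      using pauli_mean_anticommuting[of y x u] that label_line_subset[of N] by auto
  qed
  have fin: "finite labels"
    by (simp add: labels_def)
  have "4 * complex_of_real ((cmod (inner4 v w))\<^sup>2) =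
      (\<Sum>x\<in>insert (0, 0) (labels - {(0, 0)}). pauli_mean x v * pauli_mean x w)"
    unfolding sum_pauli_mean[symmetric] by (rule sum.cong) (auto simp: labels_def)
  also have "\<dots> = 1 + (\<Sum>x\<in>labels - {(0, 0)}. pauli_mean x v * pauli_mean x w)"
    using fin v w by (subst sum.insert) (simp_all add: pauli_mean_identity)
  also have "(\<Sum>x\<in>labels - {(0, 0)}. pauli_mean x v * pauli_mean x w) =
      (\<Sum>x\<in>L \<inter> M. pauli_mean x v * pauli_mean x w)"
  proof (rule sum.mono_neutral_right)
    show "\<forall>x\<in>labels - {(0, 0)} - L \<inter> M. pauli_mean x v * pauli_mean x w = 0"
      using zero[OF L _ _ v] zero[OF M _ _ w] by auto
  qed (use fin label_line_subset[OF L] in auto)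
  finally show ?thesis .
qed

lemma common_eigenbasisD:
  assumes "common_eigenbasis (pauli ` L) B" "k < 4"
  shows "inner4 (B k) (B k) = 1" "\<And>x. x \<in> L \<Longrightarrow> eigvec4 (pauli x) (B k)"
  using assms by (auto simp: common_eigenbasis_def onb4_def)

lemma mutually_unbiased_line_iff:
  assumes L: "L \<in> set label_lines" and M: "M \<in> set label_lines"
    and A: "common_eigenbasis (pauli ` L) A" and B: "common_eigenbasis (pauli ` M) B"
  shows "mutually_unbiased A B \<longleftrightarrow> L \<inter> M = {}"
proof
  assume disj: "L \<inter> M = {}"
  have "cmod (inner4 (A k) (B l)) = 1 / sqrt 4" if "k < 4" "l < 4" for k l
  proof -
    have "4 * complex_of_real ((cmod (inner4 (A k) (B l)))\<^sup>2) = 1"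
      using cmod_inner4_line_eigenvectors[OF L M common_eigenbasisD[OF A] common_eigenbasisD[OF B]]
        that disj by simp
    then have "complex_of_real (4 * (cmod (inner4 (A k) (B l)))\<^sup>2) = complex_of_real 1"
      by simp
    then have "4 * (cmod (inner4 (A k) (B l)))\<^sup>2 = 1"
      unfolding of_real_eq_iff .
    then have "(cmod (inner4 (A k) (B l)))\<^sup>2 = (1 / 2)\<^sup>2"
      by (simp add: power2_eq_square)
    then show ?thesis
      by (subst (asm) power2_eq_iff_nonneg) simp_all
  qed
  with A B show "mutually_unbiased A B"
    by (simp add: mutually_unbiased_def common_eigenbasis_def)
next
  assume unb: "mutually_unbiased A B"
  let ?v = "A 0" and ?w = "B 0"
  have half: "cmod (inner4 ?v ?w) = 1 / 2"
    using unb by (simp add: mutually_unbiased_def)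
  then have nz: "inner4 ?v ?w \<noteq> 0"
    by auto
  have "pauli_mean x ?v * pauli_mean x ?w = 1" if x: "x \<in> L \<inter> M" for x
  proof -
    have "x \<in> labels"
      using x label_line_subset[OF L] by auto
    moreover have "eigvec4 (pauli x) ?v" "inner4 ?v ?v = 1" "eigvec4 (pauli x) ?w" "inner4 ?w ?w = 1"
      using x common_eigenbasisD[OF A, of 0] common_eigenbasisD[OF B, of 0] by auto
    ultimately show ?thesis
      using pauli_mean_eq_of_not_orthogonal[of x ?v ?w] pauli_mean_eigvec4_square[of x ?w] nz
      by simp
  qed
  \<comment> \<open>Each shared label contributes exactly 1, while unbiasedness makes the left side
    1, leaving no room for a shared label.\<close>
  then have "4 * complex_of_real ((1 / 2)\<^sup>2) = 1 + of_nat (card (L \<inter> M))"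
    using cmod_inner4_line_eigenvectors[OF L M common_eigenbasisD[OF A, of 0]
        common_eigenbasisD[OF B, of 0]]
    unfolding half by simp
  then have "card (L \<inter> M) = 0"
    by (simp add: power2_eq_square)
  moreover have "finite (L \<inter> M)"
    using L label_lines_commuting finite_subset[of L "set nonid_labels"] by auto
  ultimately show "L \<inter> M = {}"
    by simp
qed

text \<open>Turns pairwise unbiasedness into distinctness of the bases.\<close>

lemma not_mutually_unbiased_self: "\<not> mutually_unbiased B B"
proof
  assume "mutually_unbiased B B"
  then have "onb4 B" "cmod (inner4 (B 0) (B 0)) = 1 / 2"
    by (simp_all add: mutually_unbiased_def)
  moreover from this(1) have "inner4 (B 0) (B 0) = 1"
    by (simp add: onb4_def)
  ultimately show False
    by simp
qed

section \<open>Complete sets of classes and the exchanged triple\<close>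

text \<open>Exactly four lines avoid \<open>A\<close> and \<open>B\<close>. Three of them are the
  pairwise disjoint \<open>S1\<close>, \<open>S2\<close>, \<open>S3\<close>, so the line meeting all
  four must be the remaining one.\<close>

lemma exists_transversal_line:
  assumes lines: "A \<in> set label_lines" "B \<in> set label_lines"
      "S1 \<in> set label_lines" "S2 \<in> set label_lines" "S3 \<in> set label_lines"
    and "A \<inter> B = {}"
    and disj_A: "S1 \<inter> A = {}" "S2 \<inter> A = {}" "S3 \<inter> A = {}"
    and disj_B: "S1 \<inter> B = {}" "S2 \<inter> B = {}" "S3 \<inter> B = {}"
    and disj: "S1 \<inter> S2 = {}" "S1 \<inter> S3 = {}" "S2 \<inter> S3 = {}"
  obtains S where "S \<in> set label_lines" "S \<inter> A = {}" "S \<inter> B = {}" "S \<notin> {S1, S2, S3}"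
    "\<forall>T\<in>set label_lines. T \<inter> A = {} \<and> T \<inter> B = {} \<longrightarrow> T \<in> {S, S1, S2, S3} \<and> T \<inter> S \<noteq> {}"
proof -
  define F where "F = {L \<in> set label_lines. L \<inter> A = {} \<and> L \<inter> B = {}}"
  let ?Ls = "filter (\<lambda>L. L \<inter> A = {} \<and> L \<inter> B = {}) label_lines"
  have F: "F = set ?Ls"
    by (auto simp: F_def)
  have "length ?Ls = 4 \<and> (\<exists>S\<in>set ?Ls. \<forall>T\<in>set ?Ls. T \<inter> S \<noteq> {})"
    using label_lines_disjoint_pair lines \<open>A \<inter> B = {}\<close> unfolding Let_def by blast
  then obtain S where S: "S \<in> F" "\<And>T. T \<in> F \<Longrightarrow> T \<inter> S \<noteq> {}" and len: "length ?Ls = 4"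
    unfolding F by blast
  have card: "card F = 4"
    unfolding F using len distinct_card[OF distinct_filter[OF distinct_label_lines]] by simp
  have Si: "S1 \<in> F" "S2 \<in> F" "S3 \<in> F"
    using lines disj_A disj_B by (auto simp: F_def)
  have new: "S \<notin> {S1, S2, S3}"
    using S(2)[OF Si(1)] S(2)[OF Si(2)] disj by auto
  \<comment> \<open>Each of these lines is nonempty since it meets \<open>S\<close>, so disjointness
    implies distinctness.\<close>
  have "S1 \<noteq> S2" "S1 \<noteq> S3" "S2 \<noteq> S3"
    using S(2)[OF Si(1)] S(2)[OF Si(2)] S(2)[OF Si(3)] disj by auto
  then have "card {S, S1, S2, S3} = card F"
    using new card by auto
  then have "{S, S1, S2, S3} = F"
    using S Si F by (intro card_subset_eq) auto
  then show ?thesis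
    using that[of S] S new by (auto simp: F_def)
qed

theorem theorem1:
  fixes S1 S2 S3 S4 S5 :: "cmat set"
  assumes complete: "disjoint_classes {S1, S2, S3, S4, S5}"
    and distinct: "distinct [S1, S2, S3, S4, S5]"
    and cover: "S1 \<union> S2 \<union> S3 \<union> S4 \<union> S5 = nonid_paulis"
  shows "(\<exists>!S. max_comm_class S \<and> S \<subseteq> S1 \<union> S2 \<union> S3 \<and> S \<notin> {S1, S2, S3}) \<and>
    (\<forall>S. max_comm_class S \<and> S \<subseteq> S1 \<union> S2 \<union> S3 \<and> S \<notin> {S1, S2, S3} \<longrightarrow>
           unextendible_classes {S, S4, S5} \<and> card {S, S4, S5} = 3 \<and>
           (\<exists>B. common_eigenbasis S B) \<and> (\<exists>B. common_eigenbasis S4 B) \<and>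
           (\<exists>B. common_eigenbasis S5 B) \<and>
           (\<forall>B B4 B5. common_eigenbasis S B \<and> common_eigenbasis S4 B4 \<and>
              common_eigenbasis S5 B5 \<longrightarrow>
              card {B, B4, B5} = 3 \<and> weakly_unextendible {B, B4, B5}))"
proof -
  have "max_comm_class S1" "max_comm_class S2" "max_comm_class S3" "max_comm_class S4"
    "max_comm_class S5"
    using complete by (auto simp: disjoint_classes_def)
  then obtain L1 L2 L3 L4 L5 where
    L: "L1 \<in> set label_lines" "L2 \<in> set label_lines" "L3 \<in> set label_lines"
      "L4 \<in> set label_lines" "L5 \<in> set label_lines"
    and S_eq: "S1 = pauli ` L1" "S2 = pauli ` L2" "S3 = pauli ` L3" "S4 = pauli ` L4" "S5 = pauli ` L5"
    unfolding max_comm_class_iff by blast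
  have "C \<inter> D = {}"
    if "C \<noteq> D" "C \<in> {S1, S2, S3, S4, S5}" "D \<in> {S1, S2, S3, S4, S5}" for C D
    using complete that unfolding disjoint_classes_def by blast
  then have disj_S: "S1 \<inter> S2 = {}" "S1 \<inter> S3 = {}" "S2 \<inter> S3 = {}" "S1 \<inter> S4 = {}" "S2 \<inter> S4 = {}"
    "S3 \<inter> S4 = {}" "S1 \<inter> S5 = {}" "S2 \<inter> S5 = {}" "S3 \<inter> S5 = {}" "S4 \<inter> S5 = {}"
    using distinct by simp_all
  have disj: "L1 \<inter> L2 = {}" "L1 \<inter> L3 = {}" "L2 \<inter> L3 = {}" "L1 \<inter> L4 = {}" "L2 \<inter> L4 = {}"
    "L3 \<inter> L4 = {}" "L1 \<inter> L5 = {}" "L2 \<inter> L5 = {}" "L3 \<inter> L5 = {}" "L4 \<inter> L5 = {}"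
    using disj_S by (simp_all add: S_eq L pauli_image_Int_empty_iff)
  obtain T where T: "T \<in> set label_lines" "T \<inter> L4 = {}" "T \<inter> L5 = {}" "T \<notin> {L1, L2, L3}"
    and T_only: "\<forall>M\<in>set label_lines. M \<inter> L4 = {} \<and> M \<inter> L5 = {} \<longrightarrow>
      M \<in> {T, L1, L2, L3} \<and> M \<inter> T \<noteq> {}"
    by (rule exists_transversal_line[OF L(4,5,1,2,3) disj(10,4-9,1-3)])
  \<comment> \<open>Since the five disjoint classes cover all nonidentity operators, lying in the
    first three amounts to avoiding the last two.\<close>
  have sub_iff: "pauli ` M \<subseteq> S1 \<union> S2 \<union> S3 \<longleftrightarrow> M \<inter> L4 = {} \<and> M \<inter> L5 = {}"
    if M: "M \<in> set label_lines" for M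
  proof -
    have "pauli ` M \<subseteq> nonid_paulis"
      using label_line_subset[OF M] by (auto simp: nonid_paulis_eq)
    moreover have "(S1 \<union> S2 \<union> S3) \<inter> (S4 \<union> S5) = {}"
      using disj_S by (simp add: Int_Un_distrib Int_Un_distrib2)
    ultimately have "pauli ` M \<subseteq> S1 \<union> S2 \<union> S3 \<longleftrightarrow> pauli ` M \<inter> S4 = {} \<and> pauli ` M \<inter> S5 = {}"
      using cover by blast
    then show ?thesis
      using M L by (simp add: S_eq pauli_image_Int_empty_iff)
  qed
  have eq_iff: "pauli ` M = pauli ` N \<longleftrightarrow> M = N" if "M \<in> set label_lines" "N \<in> set label_lines" for M N
    using inj_on_image_eq_iff[OF inj_on_pauli, of M N] that[THEN label_line_subset] by auto
  have char: "max_comm_class S \<and> S \<subseteq> S1 \<union> S2 \<union> S3 \<and> S \<notin> {S1, S2, S3} \<longleftrightarrow> S = pauli ` T" for S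
  proof
    assume S: "max_comm_class S \<and> S \<subseteq> S1 \<union> S2 \<union> S3 \<and> S \<notin> {S1, S2, S3}"
    then obtain M where M: "M \<in> set label_lines" "S = pauli ` M"
      by (auto simp: max_comm_class_iff)
    then have "M \<inter> L4 = {} \<and> M \<inter> L5 = {}"
      using S sub_iff by simp
    then have "M \<in> {T, L1, L2, L3}"
      using T_only M(1) by simp
    then show "S = pauli ` T"
      using S M by (auto simp: S_eq)
  next
    assume "S = pauli ` T"
    then show "max_comm_class S \<and> S \<subseteq> S1 \<union> S2 \<union> S3 \<and> S \<notin> {S1, S2, S3}"
      using T L sub_iff[of T] by (auto simp: max_comm_class_iff S_eq eq_iff)
  qed
  \<comment> \<open>Used twice below: it rules out both a further class and a further common
    eigenbasis.\<close>
  have meets: "M \<inter> T \<noteq> {} \<or> M \<inter> L4 \<noteq> {} \<or> M \<inter> L5 \<noteq> {}" if "M \<in> set label_lines" for M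
    using T_only[rule_format, OF that] by argo
  let ?S = "pauli ` T"
  have disj_T: "?S \<inter> S4 = {}" "?S \<inter> S5 = {}" "S4 \<inter> S5 = {}"
    using T L disj by (simp_all add: S_eq pauli_image_Int_empty_iff)
  have classes: "max_comm_class ?S" "max_comm_class S4" "max_comm_class S5"
    using T L by (auto simp: max_comm_class_iff S_eq)
  have unext: "unextendible_classes {?S, S4, S5}"
    unfolding unextendible_classes_def
  proof
    show "disjoint_classes {?S, S4, S5}"
      using disj_T classes by (auto simp: disjoint_classes_def)
    show "\<not> (\<exists>C. max_comm_class C \<and> C \<subseteq> nonid_paulis - \<Union> {?S, S4, S5})"
    proof
      assume "\<exists>C. max_comm_class C \<and> C \<subseteq> nonid_paulis - \<Union> {?S, S4, S5}"
      then obtain M where M: "M \<in> set label_lines" "pauli ` M \<subseteq> nonid_paulis - \<Union> {?S, S4, S5}"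
        by (auto simp: max_comm_class_iff)
      then have "pauli ` M \<inter> ?S = {}" "pauli ` M \<inter> S4 = {}" "pauli ` M \<inter> S5 = {}"
        by auto
      then show False
        using meets[OF M(1)] M T L by (auto simp: S_eq pauli_image_Int_empty_iff)
    qed
  qed
  have "?S \<noteq> {}" "S4 \<noteq> {}" "S5 \<noteq> {}"
    using classes by (auto simp: max_comm_class_def)
  then have "?S \<noteq> S4" "?S \<noteq> S5" "S4 \<noteq> S5"
    using disj_T by auto
  then have card: "card {?S, S4, S5} = 3"
    by simp
  have bases: "\<exists>B. common_eigenbasis ?S B" "\<exists>B. common_eigenbasis S4 B" "\<exists>B. common_eigenbasis S5 B"
    using T L by (simp_all add: S_eq exists_common_eigenbasis)
  have weak: "card {B, B4, B5} = 3 \<and> weakly_unextendible {B, B4, B5}"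
    if "common_eigenbasis ?S B \<and> common_eigenbasis S4 B4 \<and> common_eigenbasis S5 B5" for B B4 B5
  proof -
    have B: "common_eigenbasis (pauli ` T) B" "common_eigenbasis (pauli ` L4) B4"
      "common_eigenbasis (pauli ` L5) B5"
      using that by (simp_all add: S_eq)
    note unb = mutually_unbiased_line_iff
    have mub: "mutually_unbiased B B4" "mutually_unbiased B4 B" "mutually_unbiased B B5"
      "mutually_unbiased B5 B" "mutually_unbiased B4 B5" "mutually_unbiased B5 B4"
      using unb[OF T(1) L(4) B(1,2)] unb[OF L(4) T(1) B(2,1)] unb[OF T(1) L(5) B(1,3)]
        unb[OF L(5) T(1) B(3,1)] unb[OF L(4,5) B(2,3)] unb[OF L(5,4) B(3,2)] T disj
      by (simp_all add: Int_commute)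
    have "B \<noteq> B4" "B \<noteq> B5" "B4 \<noteq> B5"
      using mub not_mutually_unbiased_self by auto
    then have "card {B, B4, B5} = 3"
      by simp
    \<comment> \<open>By \<open>mutually_unbiased_line_iff\<close>, unbiasedness to all three bases
      would make the line of \<open>C\<close> disjoint from \<open>T\<close>, \<open>L4\<close> and
      \<open>L5\<close>, contrary to \<open>meets\<close>.\<close>
    moreover have False
      if C: "max_comm_class C" "common_eigenbasis C D" "\<forall>A\<in>{B, B4, B5}. mutually_unbiased A D"
      for C D
    proof -
      obtain M where M: "M \<in> set label_lines" "C = pauli ` M"
        using C(1) by (auto simp: max_comm_class_iff)
      have D: "common_eigenbasis (pauli ` M) D"
        using C(2) M by simp
      show False
        using meets[OF M(1)] C(3) unb[OF T(1) M(1) B(1) D] unb[OF L(4) M(1) B(2) D]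
          unb[OF L(5) M(1) B(3) D] by (auto simp: Int_commute)
    qed
    ultimately show ?thesis
      using mub by (auto simp: weakly_unextendible_def)
  qed
  show ?thesis
    unfolding char using unext card bases weak by simp
qed

end
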